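(* Let $\alpha>0$, $A\in\mathbb{R}^{M\times N}$, $Y\in\mathbb{R}^{M\times K}$, and for $\gamma\in[0,1]$ let $J_\gamma(Z)=\Psi_\gamma(Z)+\frac1{2\alpha}\|AZ-Y\|_{\mathrm{Fro}}^2$ for $Z\in\mathbb{R}^{N\times K}$. Then any cluster point of (global) minimizers $\bar Z_\gamma$ of $J_\gamma$ as $0<\gamma\to0$ is a (global) minimizer of $$\min_{Z\in\mathbb{R}^{N\times K}}\Big(\mathit{ow}\ell_{2,1}(Z)+\frac1{2\alpha}\|AZ-Y\|_{\mathrm{Fro}}^2\Big).$$
   Context: $\Psi_\gamma(Z)=\|Z(\gamma I+(1-\gamma)Z^TZ)^{\dagger/2}\|_{2,1}$, where $\|\cdot\|_{2,1}$ is the sum of the Euclidean norms of the rows and $(\cdot)^{\dagger/2}$ is the square root of the Moore–Penrose pseudo-inverse of a symmetric nonnegative matrix. $\mathit{ow}\ell_{2,1}(Z)=\Psi_0(Z)=\|Z(Z^TZ)^{\dagger/2}\|_{2,1}$. $\|\cdot\|_{\mathrm{Fro}}$ is the Frobenius norm. A cluster point means a limit of $\bar Z_{\gamma_k}$ along some sequence $0<\gamma_k\to0$. *)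

theory Defs
  imports "HOL-Analysis.Analysis"
begin

section \<open>Moore--Penrose pseudo-inverse and matrix square root\<close>

definition is_pinv :: "real ^ 'n ^ 'm \<Rightarrow> real ^ 'm ^ 'n \<Rightarrow> bool" where
  "is_pinv A P \<longleftrightarrow>
     A ** P ** A = A \<and>
     P ** A ** P = P \<and>
     transpose (A ** P) = A ** P \<and>
     transpose (P ** A) = P ** A"

text \<open>Every real matrix has exactly one matrix satisfying the four Penrose equations, so the
  description is proper; uniqueness is \<open>pinv_eqI\<close> below.\<close>

definition pinv :: "real ^ 'n ^ 'm \<Rightarrow> real ^ 'm ^ 'n" where
  "pinv A = (THE P. is_pinv A P)"

lemma is_pinv_unique:
  assumes P: "is_pinv A P" and Q: "is_pinv A Q"
  shows "P = Q"
proof -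
  have AP: "A ** P = A ** Q"
  proof -
    have "A ** P = transpose (A ** Q ** A ** P)"
      using P Q by (simp add: is_pinv_def)
    also have "\<dots> = transpose (A ** P) ** transpose (A ** Q)"
      by (metis matrix_mul_assoc matrix_transpose_mul)
    also have "\<dots> = A ** P ** A ** Q"
      using P Q by (simp add: is_pinv_def matrix_mul_assoc)
    also have "\<dots> = A ** Q"
      using P by (simp add: is_pinv_def)
    finally show ?thesis .
  qed
  have PA: "P ** A = Q ** A"
  proof -
    have "P ** A = transpose (P ** (A ** Q ** A))"
      using P Q by (simp add: is_pinv_def)
    also have "\<dots> = transpose (Q ** A) ** transpose (P ** A)"
      by (metis matrix_mul_assoc matrix_transpose_mul)
    also have "\<dots> = Q ** (A ** P ** A)"
      using P Q unfolding is_pinv_def by (metis matrix_mul_assoc)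
    also have "\<dots> = Q ** A"
      using P by (simp add: is_pinv_def)
    finally show ?thesis .
  qed
  have "P = P ** A ** P" using P by (simp add: is_pinv_def)
  also have "\<dots> = Q ** A ** P" by (simp add: PA)
  also have "\<dots> = Q ** A ** Q" by (metis AP matrix_mul_assoc)
  also have "\<dots> = Q" using Q by (simp add: is_pinv_def)
  finally show ?thesis .
qed

lemma pinv_eqI: "is_pinv A P \<Longrightarrow> pinv A = P"
  unfolding pinv_def by (blast intro: the_equality is_pinv_unique)

definition sym_nonneg :: "real ^ 'n ^ 'n \<Rightarrow> bool" where
  "sym_nonneg A \<longleftrightarrow> transpose A = A \<and> (\<forall>x. 0 \<le> x \<bullet> (A *v x))"

text \<open>For symmetric nonnegative \<open>A\<close> this is the unique symmetric nonnegative square root;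
  it is not meaningful for other \<open>A\<close>.\<close>

definition msqrt :: "real ^ 'n ^ 'n \<Rightarrow> real ^ 'n ^ 'n" where
  "msqrt A = (THE B. sym_nonneg B \<and> B ** B = A)"

section \<open>Norms and functionals\<close>

definition norm21 :: "real ^ 'k ^ 'n \<Rightarrow> real" where
  "norm21 Z = (\<Sum>i\<in>UNIV. norm (row i Z))"

text \<open>The library norm on \<open>real ^ 'k ^ 'm\<close> is the Frobenius norm.\<close>

lemma norm_eq_Frobenius:
  fixes X :: "real ^ 'k ^ 'm"
  shows "norm X = sqrt (\<Sum>i\<in>UNIV. \<Sum>j\<in>UNIV. (X $ i $ j)\<^sup>2)"
  by (simp add: norm_vec_def L2_set_def sum_nonneg)

definition Psi :: "real \<Rightarrow> real ^ 'k ^ 'n \<Rightarrow> real" where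
  "Psi \<gamma> Z =
     norm21 (Z ** msqrt (pinv (\<gamma> *\<^sub>R mat 1 + (1 - \<gamma>) *\<^sub>R (transpose Z ** Z))))"

definition owl21 :: "real ^ 'k ^ 'n \<Rightarrow> real" where
  "owl21 Z = norm21 (Z ** msqrt (pinv (transpose Z ** Z)))"

lemma owl21_eq_Psi_0: "owl21 Z = Psi 0 Z"
  by (simp add: owl21_def Psi_def)

definition J ::
  "real \<Rightarrow> real ^ 'n ^ 'm \<Rightarrow> real ^ 'k ^ 'm \<Rightarrow> real \<Rightarrow> real ^ 'k ^ 'n \<Rightarrow> real" where
  "J \<alpha> A Y \<gamma> Z = Psi \<gamma> Z + 1 / (2 * \<alpha>) * (norm (A ** Z - Y))\<^sup>2"

end

theory Submission
  imports Defs
begin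

text \<open>
  Put \<open>M = \<gamma> I + (1 - \<gamma>) Z\<^sup>T Z\<close>. For a row \<open>z\<close> of \<open>Z\<close>, the corresponding row of the matrix whose
  norm is \<open>\<Psi>\<^sub>\<gamma> Z\<close> has squared length \<open>z \<bullet> M\<^sup>\<dagger> z\<close>. Since \<open>z\<close> lies in the range of \<open>M\<close>,
  this is the maximum over \<open>x\<close> of \<open>2 (x \<bullet> z) - \<gamma> |x|\<^sup>2 - (1 - \<gamma>) |Z x|\<^sup>2\<close>.
  As a supremum of functions continuous in \<open>(\<gamma>, Z)\<close> it is jointly lower semicontinuous; dropping the
  term \<open>\<gamma> |x|\<^sup>2\<close> gives the upper bound \<open>sqrt (1 - \<gamma>) \<Psi>\<^sub>\<gamma> \<le> \<Psi>\<^sub>0\<close>. Hence \<open>J\<^sub>\<gamma>\<close> Gamma-converges to \<open>J\<^sub>0\<close>,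
  and limits of minimizers are minimizers.
\<close>

section \<open>The spectral theorem for symmetric real matrices\<close>

text \<open>Rayleigh's principle: a maximizer of \<open>x \<bullet> f x\<close> on the unit sphere
  of \<open>S\<close> is an eigenvector, with the maximum as eigenvalue.\<close>

lemma selfadjoint_eigenvector:
  fixes f :: "'a::euclidean_space \<Rightarrow> 'a"
  assumes lin: "linear f" and adj: "\<And>x y. f x \<bullet> y = x \<bullet> f y"
    and S: "subspace S" and inv: "\<And>x. x \<in> S \<Longrightarrow> f x \<in> S" and ne: "S \<noteq> {0}"
  obtains v c where "v \<in> S" "norm v = 1" "f v = c *\<^sub>R v"
proof -
  let ?U = "S \<inter> sphere 0 1"
  obtain a where a: "a \<in> S" "a \<noteq> 0"
    using ne subspace_0[OF S] by blast
  have "(1 / norm a) *\<^sub>R a \<in> ?U"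
    using a S by (simp add: subspace_scale)
  then have U: "?U \<noteq> {}" by blast
  have "compact ?U"
    using closed_subspace[OF S] by (simp add: closed_Int_compact)
  moreover have "continuous_on ?U (\<lambda>x. x \<bullet> f x)"
    using lin by (intro continuous_intros linear_continuous_on) (simp add: linear_linear)
  ultimately obtain v where v: "v \<in> ?U" and max: "\<And>y. y \<in> ?U \<Longrightarrow> y \<bullet> f y \<le> v \<bullet> f v"
    using continuous_attains_sup[OF _ U] by blast
  define c where "c = v \<bullet> f v"
  have vv: "v \<bullet> v = 1" using v by (simp add: dot_square_norm)
  define g where "g y = c * (y \<bullet> y) - y \<bullet> f y" for y
  have g: "g y \<ge> 0" if "y \<in> S" for y
  proof (cases "y = 0")
    case False
    have "(1 / norm y) *\<^sub>R y \<in> ?U"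
      using that False S by (simp add: subspace_scale)
    from max[OF this] have "(1 / norm y)\<^sup>2 * (y \<bullet> f y) \<le> c"
      by (simp add: linear_scale[OF lin] c_def power2_eq_square)
    then show ?thesis
      using False by (simp add: g_def dot_square_norm field_simps)
  qed (simp add: g_def linear_0[OF lin])
  \<comment> \<open>\<open>w\<close> is half the gradient of \<open>g\<close> at \<open>v\<close>.
    As \<open>g\<close> is nonnegative on \<open>S\<close> and vanishes at \<open>v\<close>,
    descending along \<open>w\<close> must be impossible, which forces \<open>w = 0\<close>.\<close>
  define w where "w = c *\<^sub>R v - f v"
  have wS: "w \<in> S"
    using v S inv by (simp add: w_def subspace_diff subspace_scale)
  have expand: "g (v - t *\<^sub>R w) = t\<^sup>2 * g w - 2 * t * (w \<bullet> w)" for t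
  proof -
    have "g (v - t *\<^sub>R w) = g v - 2 * t * (w \<bullet> (c *\<^sub>R v - f v)) + t\<^sup>2 * g w"
      using adj[of w v]
      by (simp add: g_def linear_diff[OF lin] linear_scale[OF lin] inner_diff_left inner_diff_right
          inner_commute algebra_simps power2_eq_square)
    then show ?thesis
      by (simp add: g_def w_def[symmetric] vv c_def[symmetric])
  qed
  have "w \<bullet> w = 0"
  proof (rule ccontr)
    assume "w \<bullet> w \<noteq> 0"
    then have pos: "w \<bullet> w > 0" by simp
    \<comment> \<open>Small enough that the quadratic term \<open>?t\<^sup>2 * g w\<close> cannot
      outweigh the linear decrease; the \<open>+ 1\<close> keeps the denominator positive when
      \<open>g w = 0\<close>.\<close>
    let ?t = "(w \<bullet> w) / (g w + 1)"
    have K: "g w + 1 > 0" using g[OF wS] by simp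
    then have t: "?t > 0" using pos by simp
    have "0 \<le> ?t\<^sup>2 * g w - 2 * ?t * (w \<bullet> w)"
      using g[of "v - ?t *\<^sub>R w"] v wS S unfolding expand
      by (simp add: subspace_diff subspace_scale)
    then have "0 \<le> ?t * (?t * g w - 2 * (w \<bullet> w))"
      by (simp add: algebra_simps power2_eq_square)
    then have "2 * (w \<bullet> w) \<le> ?t * g w"
      using t by (metis diff_ge_0_iff_ge zero_le_mult_iff not_less)
    moreover have "?t * g w \<le> ?t * (g w + 1)"
      using t by (intro mult_left_mono) auto
    moreover have "?t * (g w + 1) = w \<bullet> w" using K by simp
    ultimately show False using pos by linarith
  qed
  then have "f v = c *\<^sub>R v" by (simp add: w_def)
  with v show thesis using that[of v c] by simp
qed

text \<open>Split off a unit eigenvector \<open>v\<close>. Self-adjointness makes its orthogonal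
  complement in \<open>S\<close> invariant, and the dimension drops; hence the induction over all
  invariant subspaces.\<close>

lemma selfadjoint_eigenbasis:
  fixes f :: "'a::euclidean_space \<Rightarrow> 'a"
  assumes lin: "linear f" and adj: "\<And>x y. f x \<bullet> y = x \<bullet> f y"
  shows "subspace S \<Longrightarrow> (\<And>x. x \<in> S \<Longrightarrow> f x \<in> S) \<Longrightarrow>
    \<exists>B. finite B \<and> B \<subseteq> S \<and> (\<forall>u\<in>B. \<forall>v\<in>B. u \<bullet> v = (if u = v then 1 else 0)) \<and>
      (\<forall>v\<in>B. \<exists>c. f v = c *\<^sub>R v) \<and> (\<forall>x\<in>S. x = (\<Sum>v\<in>B. (v \<bullet> x) *\<^sub>R v))"
proof (induction "dim S" arbitrary: S rule: less_induct)
  case less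
  note S = less.prems(1) and inv = less.prems(2)
  show ?case
  proof (cases "S = {0}")
    case True
    then show ?thesis by (intro exI[of _ "{}"]) simp
  next
    case False
    obtain v c where v: "v \<in> S" "norm v = 1" "f v = c *\<^sub>R v"
      using selfadjoint_eigenvector[OF lin adj S inv False] by blast
    have vv: "v \<bullet> v = 1" using v by (simp add: dot_square_norm)
    define T where "T = {x \<in> S. v \<bullet> x = 0}"
    have T: "subspace T"
      using S by (auto simp: T_def subspace_def inner_right_distrib)
    have invT: "f x \<in> T" if "x \<in> T" for x
      using that inv adj[of v x] v by (auto simp: T_def)
    have "v \<notin> T" using vv by (simp add: T_def)
    then have "T \<subset> S" using v(1) unfolding T_def by blast
    then have "dim T < dim S"
      using S T by (intro dim_psubset) (simp add: span_eq_iff[THEN iffD2])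
    then have "\<exists>B. finite B \<and> B \<subseteq> T \<and> (\<forall>u\<in>B. \<forall>w\<in>B. u \<bullet> w = (if u = w then 1 else 0)) \<and>
      (\<forall>u\<in>B. \<exists>c. f u = c *\<^sub>R u) \<and> (\<forall>x\<in>T. x = (\<Sum>u\<in>B. (u \<bullet> x) *\<^sub>R u))"
      by (intro less.hyps T invT)
    then obtain B where fin: "finite B" and BT: "B \<subseteq> T"
      and orth: "\<forall>u\<in>B. \<forall>w\<in>B. u \<bullet> w = (if u = w then 1 else 0)"
      and eig: "\<forall>u\<in>B. \<exists>c. f u = c *\<^sub>R u" and exp: "\<forall>x\<in>T. x = (\<Sum>u\<in>B. (u \<bullet> x) *\<^sub>R u)"
      by (elim exE conjE) (rule that)
    have vB: "v \<notin> B" using BT \<open>v \<notin> T\<close> by blast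
    have perp: "v \<bullet> u = 0" if "u \<in> B" for u using that BT by (auto simp: T_def)
    have "x = (\<Sum>u\<in>insert v B. (u \<bullet> x) *\<^sub>R u)" if "x \<in> S" for x
    proof -
      let ?y = "x - (v \<bullet> x) *\<^sub>R v"
      have "?y \<in> T"
        using that v S by (simp add: T_def subspace_diff subspace_scale inner_diff_right vv)
      from bspec[OF exp this] have "?y = (\<Sum>u\<in>B. (u \<bullet> ?y) *\<^sub>R u)" .
      also have "\<dots> = (\<Sum>u\<in>B. (u \<bullet> x) *\<^sub>R u)"
        using perp by (intro sum.cong) (auto simp: inner_diff_right inner_commute)
      finally show ?thesis using fin vB by (simp add: algebra_simps)
    qed
    moreover have "\<forall>u\<in>insert v B. \<forall>w\<in>insert v B. u \<bullet> w = (if u = w then 1 else 0)"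
      using orth perp vv vB by (auto simp: inner_commute)
    moreover have "\<forall>u\<in>insert v B. \<exists>c. f u = c *\<^sub>R u" using eig v by blast
    moreover have "insert v B \<subseteq> S" using BT v by (auto simp: T_def)
    ultimately show ?thesis
      using fin by (intro exI[of _ "insert v B"]) simp
  qed
qed

section \<open>Matrices diagonal in an orthonormal basis\<close>

definition onbasis :: "(real ^ 'n) set \<Rightarrow> bool" where
  "onbasis B \<longleftrightarrow> finite B \<and> (\<forall>u\<in>B. \<forall>v\<in>B. u \<bullet> v = (if u = v then 1 else 0)) \<and>
     (\<forall>x. x = (\<Sum>v\<in>B. (v \<bullet> x) *\<^sub>R v))"

lemma symmetric_inner:
  fixes A :: "real ^ 'n ^ 'n"
  assumes "transpose A = A"
  shows "(A *v x) \<bullet> y = x \<bullet> (A *v y)"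
  by (metis assms dot_lmul_matrix vector_transpose_matrix)

lemma symmetric_eigenbasis:
  fixes A :: "real ^ 'n ^ 'n"
  assumes "transpose A = A"
  obtains B l where "onbasis B" "\<And>v. v \<in> B \<Longrightarrow> A *v v = l v *\<^sub>R v"
proof -
  have "\<exists>B. finite B \<and> B \<subseteq> UNIV \<and> (\<forall>u\<in>B. \<forall>v\<in>B. u \<bullet> v = (if u = v then 1 else 0)) \<and>
      (\<forall>v\<in>B. \<exists>c. A *v v = c *\<^sub>R v) \<and> (\<forall>x\<in>UNIV. x = (\<Sum>v\<in>B. (v \<bullet> x) *\<^sub>R v))"
    by (rule selfadjoint_eigenbasis) (auto simp: symmetric_inner[OF assms])
  then obtain B where "onbasis B" "\<forall>v\<in>B. \<exists>c. A *v v = c *\<^sub>R v"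
    unfolding onbasis_def by blast
  then show thesis using that by metis
qed

lemma onbasis_matrix_eqI:
  fixes A C :: "real ^ 'n ^ 'm"
  assumes B: "onbasis B" and eq: "\<And>v. v \<in> B \<Longrightarrow> A *v v = C *v v"
  shows "A = C"
proof -
  have "A *v x = C *v x" for x
  proof -
    have x: "x = (\<Sum>v\<in>B. (v \<bullet> x) *\<^sub>R v)" using B by (simp add: onbasis_def)
    show ?thesis
      by (subst (1 2) x)
        (simp add: eq linear_sum[OF matrix_vector_mul_linear] linear_scale[OF matrix_vector_mul_linear])
  qed
  then show ?thesis by (simp add: matrix_eq)
qed

text \<open>For an orthonormal basis \<open>B\<close> this is the functional calculus: functions of
  a symmetric matrix arise by changing only the eigenvalues \<open>g\<close>.\<close>

definition spectral_matrix :: "(real ^ 'n) set \<Rightarrow> (real ^ 'n \<Rightarrow> real) \<Rightarrow> real ^ 'n ^ 'n" where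
  "spectral_matrix B g = (\<chi> i j. \<Sum>v\<in>B. g v * v $ i * v $ j)"

lemma transpose_spectral_matrix: "transpose (spectral_matrix B g) = spectral_matrix B g"
  by (simp add: spectral_matrix_def transpose_def vec_eq_iff mult_ac)

lemma spectral_matrix_vector:
  "spectral_matrix B g *v x = (\<Sum>v\<in>B. (g v * (v \<bullet> x)) *\<^sub>R v)"
proof -
  have "(\<Sum>j\<in>UNIV. (\<Sum>v\<in>B. g v * v $ i * v $ j) * x $ j) = (\<Sum>v\<in>B. g v * (v \<bullet> x) * v $ i)" for i
    unfolding inner_vec_def sum_distrib_right sum_distrib_left
    by (subst sum.swap) (simp add: mult_ac)
  then show ?thesis
    by (simp add: spectral_matrix_def matrix_vector_mult_def vec_eq_iff)
qed

lemma spectral_matrix_eigen: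
  assumes "onbasis B" "v \<in> B"
  shows "spectral_matrix B g *v v = g v *\<^sub>R v"
proof -
  have "(\<Sum>u\<in>B. (g u * (u \<bullet> v)) *\<^sub>R u) = (\<Sum>u\<in>B. if u = v then g v *\<^sub>R v else 0)"
    using assms by (intro sum.cong) (auto simp: onbasis_def)
  also have "\<dots> = g v *\<^sub>R v"
    using assms by (simp add: onbasis_def)
  finally show ?thesis by (simp add: spectral_matrix_vector)
qed

text \<open>Reduces the Penrose equations and the square root equation to scalar identities between
  eigenvalues.\<close>

lemma spectral_matrix_mult:
  assumes "onbasis B"
  shows "spectral_matrix B g ** spectral_matrix B h = spectral_matrix B (\<lambda>v. g v * h v)"
  by (rule onbasis_matrix_eqI[OF assms])
    (simp add: matrix_vector_mul_assoc[symmetric] spectral_matrix_eigen[OF assms]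
      linear_scale[OF matrix_vector_mul_linear])

lemma sym_nonneg_spectral_matrix:
  assumes "\<And>v. v \<in> B \<Longrightarrow> g v \<ge> 0"
  shows "sym_nonneg (spectral_matrix B g)"
proof -
  have "0 \<le> x \<bullet> (spectral_matrix B g *v x)" for x
    using assms
    by (auto simp: spectral_matrix_vector inner_sum_right inner_commute[of x] mult.assoc intro!: sum_nonneg)
  then show ?thesis by (simp add: sym_nonneg_def transpose_spectral_matrix)
qed

lemma sym_nonneg_spectral:
  assumes "sym_nonneg A"
  obtains B l where "onbasis B" "\<And>v. v \<in> B \<Longrightarrow> l v \<ge> 0" "A = spectral_matrix B l"
proof -
  obtain B l where B: "onbasis B" and eig: "\<And>v. v \<in> B \<Longrightarrow> A *v v = l v *\<^sub>R v"
    using symmetric_eigenbasis assms unfolding sym_nonneg_def by metis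
  have "l v \<ge> 0" if "v \<in> B" for v
  proof -
    have "0 \<le> v \<bullet> (A *v v)" using assms by (simp add: sym_nonneg_def)
    moreover have "v \<bullet> v = 1" using B that by (simp add: onbasis_def)
    ultimately show ?thesis by (simp add: eig[OF that])
  qed
  moreover have "A = spectral_matrix B l"
    by (rule onbasis_matrix_eqI[OF B]) (simp add: eig spectral_matrix_eigen[OF B])
  ultimately show thesis using that B by blast
qed

section \<open>Pseudo-inverse and square root\<close>

lemma sym_nonneg_pinv:
  assumes "sym_nonneg A"
  shows "is_pinv A (pinv A)" "sym_nonneg (pinv A)"
proof -
  obtain B l where B: "onbasis B" and l: "\<And>v. v \<in> B \<Longrightarrow> l v \<ge> 0" and A: "A = spectral_matrix B l"
    using sym_nonneg_spectral[OF assms] by blast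
  let ?P = "spectral_matrix B (\<lambda>v. inverse (l v))"
  \<comment> \<open>The convention \<open>inverse 0 = 0\<close> is exactly what the pseudo-inverse
    demands on the kernel.\<close>
  have "a * inverse a * a = a" "inverse a * a * inverse a = inverse a" for a :: real
    by (cases "a = 0"; simp)+
  then have P: "is_pinv A ?P"
    unfolding is_pinv_def A spectral_matrix_mult[OF B] transpose_spectral_matrix
    by (simp only: simp_thms)
  then show "is_pinv A (pinv A)" by (simp add: pinv_eqI)
  show "sym_nonneg (pinv A)"
    using l by (simp add: pinv_eqI[OF P] sym_nonneg_spectral_matrix)
qed

text \<open>On an eigenvector \<open>v\<close> of \<open>B\<close> with eigenvalue \<open>b\<close>,
  the equation reads \<open>(C + b) (C - b) v = 0\<close>. So \<open>w = (C - b) v\<close> satisfies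
  \<open>C w = - b w\<close>, and nonnegativity of \<open>C\<close> leaves only \<open>w = 0\<close>
  or \<open>b = 0\<close>.\<close>

lemma sym_nonneg_sqrt_unique:
  assumes B: "sym_nonneg B" and C: "sym_nonneg C" and eq: "B ** B = C ** C"
  shows "B = C"
proof -
  obtain E b where E: "onbasis E" and b: "\<And>v. v \<in> E \<Longrightarrow> b v \<ge> 0" and BE: "B = spectral_matrix E b"
    using sym_nonneg_spectral[OF B] by blast
  show ?thesis
  proof (rule onbasis_matrix_eqI[OF E])
    fix v assume v: "v \<in> E"
    have Bv: "B *v v = b v *\<^sub>R v" using spectral_matrix_eigen[OF E v] BE by simp
    have CC: "C *v (C *v v) = (b v * b v) *\<^sub>R v"
      using arg_cong[OF eq, of "\<lambda>X. X *v v"]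
      by (simp add: matrix_vector_mul_assoc[symmetric] Bv linear_scale[OF matrix_vector_mul_linear])
    define w where "w = C *v v - b v *\<^sub>R v"
    have "C *v w = - b v *\<^sub>R w"
      by (simp add: w_def CC linear_diff[OF matrix_vector_mul_linear]
          linear_scale[OF matrix_vector_mul_linear] algebra_simps)
    moreover have "0 \<le> w \<bullet> (C *v w)" using C by (simp add: sym_nonneg_def)
    ultimately have "b v * (w \<bullet> w) \<le> 0" by simp
    then have "b v = 0 \<or> w = 0"
      using b[OF v] by (metis inner_ge_zero inner_eq_zero_iff mult_eq_0_iff mult_nonneg_nonneg order_antisym)
    \<comment> \<open>The sign argument is void for a zero eigenvalue; there the squared length of
      \<open>C v\<close> is \<open>v \<bullet> C (C v) = 0\<close>.\<close>
    moreover have "w = 0" if "b v = 0"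
    proof -
      have "(C *v v) \<bullet> (C *v v) = v \<bullet> (C *v (C *v v))"
        using C by (simp add: sym_nonneg_def symmetric_inner)
      then show ?thesis using that by (simp add: CC w_def)
    qed
    ultimately show "B *v v = C *v v" by (auto simp: w_def Bv)
  qed
qed

text \<open>Existence by taking roots of the eigenvalues; with uniqueness this justifies the
  description in \<open>msqrt\<close>.\<close>

lemma sym_nonneg_msqrt:
  assumes "sym_nonneg A"
  shows "sym_nonneg (msqrt A) \<and> msqrt A ** msqrt A = A"
proof -
  obtain B l where B: "onbasis B" and l: "\<And>v. v \<in> B \<Longrightarrow> l v \<ge> 0" and A: "A = spectral_matrix B l"
    using sym_nonneg_spectral[OF assms] by blast
  let ?S = "spectral_matrix B (\<lambda>v. sqrt (l v))"
  have "sym_nonneg ?S" using l by (simp add: sym_nonneg_spectral_matrix)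
  moreover have "?S ** ?S = A"
    by (rule onbasis_matrix_eqI[OF B])
      (simp add: A spectral_matrix_mult[OF B] spectral_matrix_eigen[OF B] l)
  ultimately have S: "sym_nonneg ?S \<and> ?S ** ?S = A" by simp
  show ?thesis
    unfolding msqrt_def
  proof (rule theI)
    show "sym_nonneg ?S \<and> ?S ** ?S = A" by (rule S)
    show "X = ?S" if "sym_nonneg X \<and> X ** X = A" for X
      using sym_nonneg_sqrt_unique[of X ?S] that S by simp
  qed
qed

section \<open>Variational form of the row norms\<close>

definition reg_gram :: "real \<Rightarrow> real ^ 'k ^ 'n \<Rightarrow> real ^ 'k ^ 'k" where
  "reg_gram \<gamma> Z = \<gamma> *\<^sub>R mat 1 + (1 - \<gamma>) *\<^sub>R (transpose Z ** Z)"

lemma inner_reg_gram: "x \<bullet> (reg_gram \<gamma> Z *v x) = \<gamma> * (norm x)\<^sup>2 + (1 - \<gamma>) * (norm (Z *v x))\<^sup>2"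
proof -
  have "x \<bullet> (transpose Z *v (Z *v x)) = (norm (Z *v x))\<^sup>2"
    by (metis dot_lmul_matrix dot_square_norm inner_commute transpose_matrix_vector)
  then show ?thesis
    by (simp add: reg_gram_def matrix_vector_mult_add_rdistrib scaleR_matrix_vector_assoc[symmetric]
        inner_right_distrib dot_square_norm matrix_vector_mul_assoc[symmetric])
qed

lemma sym_nonneg_reg_gram:
  assumes "0 \<le> \<gamma>" "\<gamma> \<le> 1"
  shows "sym_nonneg (reg_gram \<gamma> Z)"
proof -
  have "transpose (reg_gram \<gamma> Z) = reg_gram \<gamma> Z"
    by (simp add: reg_gram_def transpose_def mat_def matrix_matrix_mult_def vec_eq_iff mult_ac)
  then show ?thesis
    using assms by (simp add: sym_nonneg_def inner_reg_gram)
qed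

definition psi_row :: "real \<Rightarrow> real ^ 'k ^ 'n \<Rightarrow> 'n \<Rightarrow> real" where
  "psi_row \<gamma> Z i = norm (row i (Z ** msqrt (pinv (reg_gram \<gamma> Z))))"

lemma Psi_eq_sum_psi_row: "Psi \<gamma> Z = (\<Sum>i\<in>UNIV. psi_row \<gamma> Z i)"
  by (simp add: Psi_def norm21_def psi_row_def reg_gram_def)

text \<open>The concave quadratic \<open>2 (x \<bullet> z) - x \<bullet> M x\<close> for a row
  \<open>z\<close> of \<open>Z\<close> and \<open>M = reg_gram \<gamma> Z\<close>, expanded so that
  continuity in \<open>\<gamma>\<close> and \<open>Z\<close> for fixed \<open>x\<close> is visible.
  The pseudo-inverse itself jumps where the rank changes.\<close>

definition dual_form :: "real \<Rightarrow> real ^ 'k ^ 'n \<Rightarrow> 'n \<Rightarrow> real ^ 'k \<Rightarrow> real" where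
  "dual_form \<gamma> Z i x = 2 * (x \<bullet> row i Z) - \<gamma> * (norm x)\<^sup>2 - (1 - \<gamma>) * (norm (Z *v x))\<^sup>2"

text \<open>The kernel of \<open>reg_gram \<gamma> Z\<close> is contained in that of \<open>Z\<close>, so the rows of \<open>Z\<close> lie in its range.\<close>

lemma row_in_range_reg_gram:
  assumes "0 \<le> \<gamma>" "\<gamma> \<le> 1"
  shows "reg_gram \<gamma> Z *v (pinv (reg_gram \<gamma> Z) *v row i Z) = row i Z"
proof -
  let ?M = "reg_gram \<gamma> Z" and ?P = "pinv (reg_gram \<gamma> Z)"
  note psd = sym_nonneg_reg_gram[OF assms, of Z]
  note P = sym_nonneg_pinv[OF psd]
  have ker: "Z *v x = 0" if "?M *v x = 0" for x
  proof -
    have "\<gamma> * (norm x)\<^sup>2 + (1 - \<gamma>) * (norm (Z *v x))\<^sup>2 = 0"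
      using that inner_reg_gram[of x \<gamma> Z] by simp
    \<comment> \<open>At least one of \<open>\<gamma>\<close> and \<open>1 - \<gamma>\<close> is
      nonzero, so either \<open>x = 0\<close> or directly \<open>Z *v x = 0\<close>.\<close>
    then have "\<gamma> * (norm x)\<^sup>2 = 0 \<and> (1 - \<gamma>) * (norm (Z *v x))\<^sup>2 = 0"
      using assms by (simp add: add_nonneg_eq_0_iff)
    then show ?thesis by auto
  qed
  have "Z *v x = Z *v (?P *v (?M *v x))" for x
  proof -
    \<comment> \<open>By the first Penrose equation, \<open>x\<close> and
      \<open>?P *v (?M *v x)\<close> differ by a kernel vector. Symmetry of both matrices later
      moves them onto the row.\<close>
    have "?M *v (x - ?P *v (?M *v x)) = 0"
      using P(1) by (simp add: is_pinv_def linear_diff[OF matrix_vector_mul_linear]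
          matrix_vector_mul_assoc matrix_mul_assoc)
    from ker[OF this] show ?thesis
      by (simp add: linear_diff[OF matrix_vector_mul_linear])
  qed
  then have "row i Z \<bullet> x = row i Z \<bullet> (?P *v (?M *v x))" for x
    by (metis matrix_vector_mul_component row_def vec_nth_inverse)
  then have "row i Z \<bullet> x = (?M *v (?P *v row i Z)) \<bullet> x" for x
    using P(2) psd by (simp add: sym_nonneg_def symmetric_inner)
  then show ?thesis by (metis vector_eq_rdot)
qed

lemma psi_row_sq:
  assumes "0 \<le> \<gamma>" "\<gamma> \<le> 1"
  shows "(psi_row \<gamma> Z i)\<^sup>2 = row i Z \<bullet> (pinv (reg_gram \<gamma> Z) *v row i Z)"
proof -
  let ?P = "pinv (reg_gram \<gamma> Z)"
  have S: "sym_nonneg (msqrt ?P)" "msqrt ?P ** msqrt ?P = ?P"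
    using sym_nonneg_msqrt sym_nonneg_pinv(2) sym_nonneg_reg_gram[OF assms] by blast+
  have "row i (Z ** msqrt ?P) = transpose (msqrt ?P) *v row i Z"
    by (simp add: vec_eq_iff row_def transpose_def matrix_vector_mult_def matrix_matrix_mult_def mult.commute)
  then have "(psi_row \<gamma> Z i)\<^sup>2 = (msqrt ?P *v row i Z) \<bullet> (msqrt ?P *v row i Z)"
    using S(1) by (simp add: psi_row_def sym_nonneg_def dot_square_norm del: transpose_matrix_vector)
  also have "\<dots> = row i Z \<bullet> (?P *v row i Z)"
    using S by (simp add: sym_nonneg_def symmetric_inner matrix_vector_mul_assoc)
  finally show ?thesis .
qed

text \<open>Completing the square: the gap is \<open>(x - w) \<bullet> M (x - w)\<close> with
  \<open>w\<close> the pseudo-inverse of \<open>M\<close> applied to the row \<open>z\<close>,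
  because \<open>M w = z\<close>.\<close>

lemma dual_form_le_psi_row:
  assumes "0 \<le> \<gamma>" "\<gamma> \<le> 1"
  shows "dual_form \<gamma> Z i x \<le> (psi_row \<gamma> Z i)\<^sup>2"
proof -
  let ?M = "reg_gram \<gamma> Z" and ?w = "pinv (reg_gram \<gamma> Z) *v row i Z"
  have psd: "transpose ?M = ?M" "\<And>y. 0 \<le> y \<bullet> (?M *v y)"
    using sym_nonneg_reg_gram[OF assms] by (auto simp: sym_nonneg_def)
  have w: "?M *v ?w = row i Z" by (rule row_in_range_reg_gram[OF assms])
  have "0 \<le> (x - ?w) \<bullet> (?M *v (x - ?w))" by (rule psd)
  also have "\<dots> = x \<bullet> (?M *v x) - 2 * (x \<bullet> row i Z) + row i Z \<bullet> ?w"
    using symmetric_inner[OF psd(1), of ?w x]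
    by (simp add: linear_diff[OF matrix_vector_mul_linear] w inner_diff_left inner_diff_right inner_commute)
  finally show ?thesis
    by (simp add: dual_form_def inner_reg_gram psi_row_sq[OF assms])
qed

lemma dual_form_attained:
  assumes "0 \<le> \<gamma>" "\<gamma> \<le> 1"
  obtains x where "dual_form \<gamma> Z i x = (psi_row \<gamma> Z i)\<^sup>2"
proof -
  let ?w = "pinv (reg_gram \<gamma> Z) *v row i Z"
  have "?w \<bullet> (reg_gram \<gamma> Z *v ?w) = ?w \<bullet> row i Z"
    by (simp add: row_in_range_reg_gram[OF assms])
  then have "dual_form \<gamma> Z i ?w = (psi_row \<gamma> Z i)\<^sup>2"
    by (simp add: dual_form_def inner_reg_gram psi_row_sq[OF assms] inner_commute)
  then show thesis by (rule that)
qed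

lemma psi_row_nonneg: "0 \<le> psi_row \<gamma> Z i"
  by (simp add: psi_row_def)

section \<open>Gamma-convergence\<close>

lemma Psi_upper:
  assumes "0 \<le> \<gamma>" "\<gamma> \<le> 1"
  shows "sqrt (1 - \<gamma>) * Psi \<gamma> Z \<le> owl21 Z"
proof -
  have "sqrt (1 - \<gamma>) * psi_row \<gamma> Z i \<le> psi_row 0 Z i" for i
  proof -
    obtain x where x: "dual_form \<gamma> Z i x = (psi_row \<gamma> Z i)\<^sup>2"
      using dual_form_attained[OF assms] .
    \<comment> \<open>The maximizer for \<open>\<gamma>\<close>, scaled by
      \<open>1 - \<gamma>\<close>, serves as a test vector for parameter 0: the factor
      \<open>1 - \<gamma>\<close> then comes out of both terms, leaving the nonnegative surplus
      \<open>\<gamma> * (norm x)\<^sup>2\<close>.\<close>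
    have "(1 - \<gamma>) * (psi_row \<gamma> Z i)\<^sup>2 \<le> dual_form 0 Z i ((1 - \<gamma>) *\<^sub>R x)"
    proof -
      have "dual_form 0 Z i ((1 - \<gamma>) *\<^sub>R x) = (1 - \<gamma>) * (dual_form \<gamma> Z i x + \<gamma> * (norm x)\<^sup>2)"
        using assms
        by (simp add: dual_form_def linear_scale[OF matrix_vector_mul_linear] power_mult_distrib)
          (simp add: power2_eq_square algebra_simps)
      then show ?thesis
        using assms by (simp add: x mult_left_mono)
    qed
    also have "\<dots> \<le> (psi_row 0 Z i)\<^sup>2" by (rule dual_form_le_psi_row) auto
    finally have "(sqrt (1 - \<gamma>) * psi_row \<gamma> Z i)\<^sup>2 \<le> (psi_row 0 Z i)\<^sup>2"
      using assms by (simp add: power_mult_distrib)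
    then show ?thesis by (rule power2_le_imp_le) (rule psi_row_nonneg)
  qed
  then show ?thesis
    by (simp add: owl21_eq_Psi_0 Psi_eq_sum_psi_row sum_distrib_left sum_mono)
qed

text \<open>The liminf inequality, expressed by a convergent minorant \<open>L\<close>. Maximizers
  for the limit \<open>Z0\<close> are kept fixed as test vectors along the sequence.\<close>

lemma Psi_lower:
  fixes Z :: "nat \<Rightarrow> real ^ 'k ^ 'n"
  assumes \<gamma>: "\<And>k. 0 \<le> \<gamma> k" "\<And>k. \<gamma> k \<le> 1" "\<gamma> \<longlonglongrightarrow> 0" and Z: "Z \<longlonglongrightarrow> Z0"
  obtains L where "\<And>k. L k \<le> Psi (\<gamma> k) (Z k)" "L \<longlonglongrightarrow> owl21 Z0"
proof -
  have "\<exists>x. dual_form 0 Z0 i x = (psi_row 0 Z0 i)\<^sup>2" for i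
    by (rule dual_form_attained[of 0 Z0 i]) auto
  then obtain x where x: "\<And>i. dual_form 0 Z0 i (x i) = (psi_row 0 Z0 i)\<^sup>2" by metis
  \<comment> \<open>\<open>dual_form\<close> may be negative for some \<open>k\<close>;
    \<open>sqrt\<close>, extended as an odd function, is then negative too and stays continuous, so
    both the bound and the limit survive.\<close>
  define L where "L k = (\<Sum>i\<in>UNIV. sqrt (dual_form (\<gamma> k) (Z k) i (x i)))" for k
  have "L k \<le> Psi (\<gamma> k) (Z k)" for k
    unfolding L_def Psi_eq_sum_psi_row
    by (intro sum_mono real_le_lsqrt dual_form_le_psi_row \<gamma> psi_row_nonneg)
  moreover have "L \<longlonglongrightarrow> owl21 Z0"
  proof -
    have row: "(\<lambda>k. row i (Z k)) \<longlonglongrightarrow> row i Z0" for i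
      using tendsto_vec_nth[OF Z] by (simp add: row_def)
    have mv: "(\<lambda>k. Z k *v y) \<longlonglongrightarrow> Z0 *v y" for y
      unfolding matrix_vector_mult_def by (intro tendsto_intros Z)
    have "(\<lambda>k. dual_form (\<gamma> k) (Z k) i (x i)) \<longlonglongrightarrow> dual_form 0 Z0 i (x i)" for i
      unfolding dual_form_def by (intro tendsto_intros row mv \<gamma>)
    then have "L \<longlonglongrightarrow> (\<Sum>i\<in>UNIV. sqrt (dual_form 0 Z0 i (x i)))"
      unfolding L_def by (intro tendsto_intros)
    then show ?thesis
      by (simp add: x owl21_eq_Psi_0 Psi_eq_sum_psi_row psi_row_nonneg)
  qed
  ultimately show thesis by (rule that)
qed

theorem proposition5p1:
  fixes \<alpha> :: real
    and A :: "real ^ 'n ^ 'm"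
    and Y :: "real ^ 'k ^ 'm"
    and Zbar :: "real \<Rightarrow> real ^ 'k ^ 'n"
    and \<gamma> :: "nat \<Rightarrow> real"
    and Z0 :: "real ^ 'k ^ 'n"
  assumes "\<alpha> > 0"
    and "\<And>i. 0 < \<gamma> i" and "\<And>i. \<gamma> i \<le> 1" and "\<gamma> \<longlonglongrightarrow> 0"
    and "\<And>i. is_arg_min (J \<alpha> A Y (\<gamma> i)) (\<lambda>_. True) (Zbar (\<gamma> i))"
    and "(\<lambda>i. Zbar (\<gamma> i)) \<longlonglongrightarrow> Z0"
  shows "is_arg_min (\<lambda>Z. owl21 Z + 1 / (2 * \<alpha>) * (norm (A ** Z - Y))\<^sup>2) (\<lambda>_. True) Z0"
proof -
  define fid where "fid Z = 1 / (2 * \<alpha>) * (norm (A ** Z - Y))\<^sup>2" for Z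
  have le: "Psi (\<gamma> k) (Zbar (\<gamma> k)) + fid (Zbar (\<gamma> k)) \<le> Psi (\<gamma> k) Z + fid Z" for k Z
    using assms(5)[of k] by (simp add: is_arg_min_linorder J_def fid_def)
  have \<gamma>0: "0 \<le> \<gamma> k" for k using assms(2) by (rule less_imp_le)
  obtain L where L: "\<And>k. L k \<le> Psi (\<gamma> k) (Zbar (\<gamma> k))" "L \<longlonglongrightarrow> owl21 Z0"
    using Psi_lower[OF \<gamma>0 assms(3,4,6)] by blast
  have mm: "(\<lambda>k. A ** Zbar (\<gamma> k)) \<longlonglongrightarrow> A ** Z0"
    unfolding matrix_matrix_mult_def by (intro tendsto_intros assms(6))
  have fid: "(\<lambda>k. fid (Zbar (\<gamma> k))) \<longlonglongrightarrow> fid Z0"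
    unfolding fid_def by (intro tendsto_intros mm)
  have "owl21 Z0 + fid Z0 \<le> owl21 Z + fid Z" for Z
  proof (rule LIMSEQ_le)
    \<comment> \<open>Scaling by \<open>sqrt (1 - \<gamma> k)\<close>, which tends to 1, matches the
      factor in \<open>Psi_upper\<close> and avoids dividing by zero when
      \<open>\<gamma> k = 1\<close>.\<close>
    show "(\<lambda>k. sqrt (1 - \<gamma> k) * (L k + fid (Zbar (\<gamma> k)))) \<longlonglongrightarrow> owl21 Z0 + fid Z0"
      by (rule tendsto_eq_intros L(2) fid assms(4) | simp)+
    show "(\<lambda>k. owl21 Z + sqrt (1 - \<gamma> k) * fid Z) \<longlonglongrightarrow> owl21 Z + fid Z"
      by (rule tendsto_eq_intros assms(4) | simp)+
    have "sqrt (1 - \<gamma> k) * (L k + fid (Zbar (\<gamma> k))) \<le> owl21 Z + sqrt (1 - \<gamma> k) * fid Z" for k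
    proof -
      \<comment> \<open>The minorant and minimality against the constant competitor \<open>Z\<close>
        give this bound; \<open>Psi_upper\<close> then replaces \<open>Psi (\<gamma> k) Z\<close> by
        \<open>owl21 Z\<close>.\<close>
      have "sqrt (1 - \<gamma> k) * (L k + fid (Zbar (\<gamma> k))) \<le> sqrt (1 - \<gamma> k) * (Psi (\<gamma> k) Z + fid Z)"
        using L(1)[of k] le[of k Z] assms(3)[of k] by (intro mult_left_mono) auto
      also have "\<dots> \<le> owl21 Z + sqrt (1 - \<gamma> k) * fid Z"
        using Psi_upper[OF \<gamma>0 assms(3), of k Z] by (simp add: distrib_left)
      finally show ?thesis .
    qed
    then show "\<exists>N. \<forall>k\<ge>N. sqrt (1 - \<gamma> k) * (L k + fid (Zbar (\<gamma> k)))
        \<le> owl21 Z + sqrt (1 - \<gamma> k) * fid Z"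
      by blast
  qed
  then show ?thesis by (simp add: is_arg_min_linorder fid_def)
qed

end
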